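(* Let $a>0$, $d>0$, let $N$ be a positive even integer, $h=2\pi/N$, and $\tau>0$. Consider the upwind scheme $$\frac{\mathrm d u_{j}}{\mathrm d t} + a\,\frac{u_{j}-u_{j-1}}{h} = d\,\frac{u_{j+1}-2u_{j}+u_{j-1}}{h^2},\qquad u_{j+N}=u_j,$$ for the periodic advection-diffusion equation $u_t+au_x=du_{xx}$, discretized in time by the ETD-RK1 method with time step $\tau$. This fully discrete scheme is stable under the time-step constraint $\tau\le \max\left\{2\frac{d}{a^2},\frac ha\right\}$.
   Context: Write the semidiscrete scheme as $\mathbf u_t=D\mathbf u-A\mathbf u$, where $(D\mathbf u)_j=d\,\frac{u_{j+1}-2u_j+u_{j-1}}{h^2}$ and $(A\mathbf u)_j=a\,\frac{u_{j}-u_{j-1}}{h}$ act on $N$-periodic complex grid functions. The ETD-RK1 method is $$\mathbf{u}^{n+1}=e^{\tau D}\mathbf{u}^n-D^{-1}\left(e^{\tau D}-I\right)A\mathbf{u}^n,$$ where $D^{-1}(e^{\tau D}-I)$ denotes $\tau\varphi_1(\tau D)$, with $\varphi_1(z)=(e^z-1)/z$, $\varphi_1(0)=1$. Stability: for each integer $\omega\in\{-\frac N2+1,\dots,\frac N2\}$, the Fourier mode $u^n_j=\widehat u^n e^{\mathrm i\omega jh}$ is a common eigenvector of $D$ and $A$, so the scheme multiplies it by a scalar growth factor $\widehat G$. The scheme is called stable if $|\widehat G|\le 1$ for all such $\omega$. *)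

theory Defs
  imports "HOL-Complex_Analysis.Complex_Analysis"
begin

text \<open>
  \<open>N\<close>-periodic grid functions are represented as functions on all of \<open>\<int>\<close>, so that the
  difference operators can be written without wrap-around. All operators below map
  \<open>N\<close>-periodic functions to \<open>N\<close>-periodic functions.
\<close>

type_synonym grid_fun = "int \<Rightarrow> complex"

definition grid_periodic :: "nat \<Rightarrow> grid_fun \<Rightarrow> bool" where
  "grid_periodic N u \<longleftrightarrow> (\<forall>j. u (j + int N) = u j)"

text \<open>The semidiscrete upwind scheme is \<open>du/dt = diff_op d h u - adv_op a h u\<close>.\<close>

definition diff_op :: "real \<Rightarrow> real \<Rightarrow> grid_fun \<Rightarrow> grid_fun" where
  "diff_op d h u = (\<lambda>j. of_real d * ((u (j + 1) - 2 * u j + u (j - 1)) / of_real (h ^ 2)))"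

definition adv_op :: "real \<Rightarrow> real \<Rightarrow> grid_fun \<Rightarrow> grid_fun" where
  "adv_op a h u = (\<lambda>j. of_real a * ((u j - u (j - 1)) / of_real h))"

text \<open>
  \<open>op_fun f L\<close> is the operator \<open>f(L)\<close> for entire \<open>f\<close>: the Taylor series of \<open>f\<close> at \<open>0\<close>,
  evaluated at \<open>L\<close>. The series is summed pointwise; on the finite-dimensional space of
  periodic grid functions this agrees with convergence in operator norm.
\<close>

definition op_fun :: "(complex \<Rightarrow> complex) \<Rightarrow> (grid_fun \<Rightarrow> grid_fun) \<Rightarrow> grid_fun \<Rightarrow> grid_fun" where
  "op_fun f L u = (\<lambda>j. \<Sum>k. fps_nth (fps_expansion f 0) k * (L ^^ k) u j)"

definition phi1 :: "complex \<Rightarrow> complex" where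
  "phi1 z = (if z = 0 then 1 else (exp z - 1) / z)"

definition scale_op :: "real \<Rightarrow> (grid_fun \<Rightarrow> grid_fun) \<Rightarrow> grid_fun \<Rightarrow> grid_fun" where
  "scale_op t L u = (\<lambda>j. of_real t * L u j)"

text \<open>
  One ETD-RK1 step for \<open>du/dt = D u - A u\<close>. The expression \<open>D\<^sup>-\<^sup>1 (exp (\<tau> D) - I)\<close>, in which
  \<open>D\<close> may be singular, is read as \<open>\<tau> \<phi>\<^sub>1(\<tau> D)\<close>.
\<close>

definition etd_rk1_step ::
  "(grid_fun \<Rightarrow> grid_fun) \<Rightarrow> (grid_fun \<Rightarrow> grid_fun) \<Rightarrow> real \<Rightarrow> grid_fun \<Rightarrow> grid_fun" where
  "etd_rk1_step D A \<tau> u =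
     (\<lambda>j. op_fun exp (scale_op \<tau> D) u j
          - scale_op \<tau> (op_fun phi1 (scale_op \<tau> D)) (A u) j)"

definition fourier_mode :: "real \<Rightarrow> int \<Rightarrow> grid_fun" where
  "fourier_mode h \<omega> = (\<lambda>j. exp (\<i> * of_int \<omega> * of_int j * of_real h))"

definition is_growth_factor :: "(grid_fun \<Rightarrow> grid_fun) \<Rightarrow> real \<Rightarrow> int \<Rightarrow> complex \<Rightarrow> bool" where
  "is_growth_factor S h \<omega> G \<longleftrightarrow>
     (\<forall>c j. S (\<lambda>i. c * fourier_mode h \<omega> i) j = G * (c * fourier_mode h \<omega> j))"

text \<open>
  A growth factor is unique if it exists (take \<open>c = 1\<close>, \<open>j = 0\<close>). The existential quantifier
  makes its existence part of the claim.
\<close>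

definition fourier_stable :: "(grid_fun \<Rightarrow> grid_fun) \<Rightarrow> nat \<Rightarrow> real \<Rightarrow> bool" where
  "fourier_stable S N h \<longleftrightarrow>
     (\<forall>\<omega> \<in> {- (int N div 2) + 1 .. int N div 2}. \<exists>G. is_growth_factor S h \<omega> G \<and> cmod G \<le> 1)"

definition upwind_etd_rk1 :: "real \<Rightarrow> real \<Rightarrow> real \<Rightarrow> real \<Rightarrow> grid_fun \<Rightarrow> grid_fun" where
  "upwind_etd_rk1 a d h \<tau> = etd_rk1_step (diff_op d h) (adv_op a h) \<tau>"

lemma grid_periodic_fourier_mode:
  assumes "N > 0" and "h = 2 * pi / real N"
  shows "grid_periodic N (fourier_mode h \<omega>)"
proof -
  have "\<i> * of_int \<omega> * of_int (j + int N) * of_real h =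
        \<i> * of_int \<omega> * of_int j * of_real h + of_int (2 * \<omega>) * (of_real pi * \<i>)" for j
    unfolding assms(2) using assms(1) by (simp add: field_simps)
  then show ?thesis
    by (simp add: grid_periodic_def fourier_mode_def exp_add exp_integer_2pi mult_ac)
qed

lemma grid_periodic_diff_op: "grid_periodic N u \<Longrightarrow> grid_periodic N (diff_op d h u)"
  and grid_periodic_adv_op: "grid_periodic N u \<Longrightarrow> grid_periodic N (adv_op a h u)"
  and grid_periodic_scale_op: "grid_periodic N (L u) \<Longrightarrow> grid_periodic N (scale_op t L u)"
proof -
  have shift: "u (j + int N + 1) = u (j + 1)" "u (j + int N - 1) = u (j - 1)"
    if "grid_periodic N u" for j
    using that[unfolded grid_periodic_def, rule_format, of "j + 1"]
      that[unfolded grid_periodic_def, rule_format, of "j - 1"] by (simp_all add: algebra_simps)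
  show "grid_periodic N (diff_op d h u)" if "grid_periodic N u"
    using that shift[OF that] unfolding grid_periodic_def diff_op_def by simp
  show "grid_periodic N (adv_op a h u)" if "grid_periodic N u"
    using that shift[OF that] unfolding grid_periodic_def adv_op_def by simp
  show "grid_periodic N (scale_op t L u)" if "grid_periodic N (L u)"
    using that by (simp add: grid_periodic_def scale_op_def)
qed

lemma grid_periodic_op_fun:
  assumes "\<And>v. grid_periodic N v \<Longrightarrow> grid_periodic N (L v)" and "grid_periodic N u"
  shows "grid_periodic N (op_fun f L u)"
proof -
  have "grid_periodic N ((L ^^ k) u)" for k
    by (induction k) (auto intro: assms)
  then show ?thesis by (simp add: grid_periodic_def op_fun_def)
qed

lemma grid_periodic_upwind_etd_rk1:
  assumes "grid_periodic N u"
  shows "grid_periodic N (upwind_etd_rk1 a d h \<tau> u)"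
proof -
  let ?D = "diff_op d h"
  have D: "grid_periodic N (scale_op \<tau> ?D v)" if "grid_periodic N v" for v
    using that by (intro grid_periodic_scale_op grid_periodic_diff_op)
  have "grid_periodic N (op_fun exp (scale_op \<tau> ?D) u)"
    "grid_periodic N (scale_op \<tau> (op_fun phi1 (scale_op \<tau> ?D)) (adv_op a h u))"
    by (intro grid_periodic_scale_op grid_periodic_op_fun grid_periodic_adv_op D assms; assumption)+
  then show ?thesis
    by (simp add: grid_periodic_def upwind_etd_rk1_def etd_rk1_step_def)
qed

lemma phi1_holomorphic: "phi1 holomorphic_on UNIV"
proof (rule no_isolated_singularity)
  have "(\<lambda>z. (exp z - 1) / z) holomorphic_on UNIV - {0}"
    by (auto intro!: holomorphic_intros)
  then show hol: "phi1 holomorphic_on UNIV - {0}"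
    by (rule holomorphic_transform) (simp add: phi1_def)
  have "(phi1 \<longlongrightarrow> 1) (at 0)"
    using lim_exp_minus_1[where 'a = complex]
    by (rule Lim_transform_eventually) (auto simp: phi1_def eventually_at_filter)
  then have "isCont phi1 0"
    by (simp add: isCont_def phi1_def)
  moreover have "isCont phi1 z" if "z \<noteq> 0" for z
    using holomorphic_on_imp_continuous_on[OF hol] that
    by (simp add: continuous_on_eq_continuous_at open_delete)
  ultimately show "continuous_on UNIV phi1"
    by (metis continuous_at_imp_continuous_on)
qed auto

text \<open>\<open>op_fun\<close> acts as expected on eigenvectors.\<close>

lemma op_fun_eigenvector:
  assumes f: "f holomorphic_on UNIV"
    and L: "\<And>c. L (\<lambda>j. c * u j) = (\<lambda>j. \<mu> * c * u j)"
  shows "op_fun f L u j = f \<mu> * u j"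
proof -
  have pow: "(L ^^ k) u = (\<lambda>j. \<mu> ^ k * u j)" for k
  proof (induction k)
    case (Suc k)
    then show ?case by (simp add: L)
  qed simp
  have "(\<lambda>k. fps_nth (fps_expansion f 0) k * (\<mu> - 0) ^ k) sums f \<mu>"
    using holomorphic_power_series[of f 0 "norm \<mu> + 1" \<mu>] holomorphic_on_subset[OF f]
    by (simp add: fps_expansion_def)
  then have "(\<lambda>k. fps_nth (fps_expansion f 0) k * \<mu> ^ k * u j) sums (f \<mu> * u j)"
    using sums_mult2 by fastforce
  then show ?thesis
    by (simp add: op_fun_def pow sums_iff mult_ac)
qed

end

theory Submission
  imports Defs
begin

text \<open>
  With \<open>\<theta> = \<omega> h\<close>, \<open>s = 1 - cos \<theta>\<close>, \<open>\<sigma> = a \<tau> / h\<close>, \<open>q = d \<tau> / h\<^sup>2\<close>, \<open>x = 2 q s\<close>,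
  \<open>E = exp (- x)\<close> and \<open>\<phi> = (1 - E) / x\<close>, the growth factor is
  \<open>G = E - \<phi> \<sigma> (s + \<i> sin \<theta>)\<close>, and \<open>x \<phi> = 1 - E\<close> yields
  \<open>1 - |G|\<^sup>2 = 2 s \<phi> (q (1 + E) + \<sigma> E - \<phi> \<sigma>\<^sup>2)\<close>.
  If \<open>\<sigma>\<^sup>2 \<le> 2 q\<close>, the bracket is nonnegative because \<open>2 \<phi> \<le> 1 + E\<close>. If \<open>\<sigma> \<le> 1\<close>, it is
  nonnegative because \<open>4 (\<phi> - E) \<le> x (1 + E)\<close> and \<open>x \<le> 4 q\<close>. Clearing the denominator \<open>x\<close>,
  both bounds on \<open>\<phi>\<close> follow by differentiation from \<open>(1 + x) E \<le> 1\<close>.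
\<close>

lemma one_plus_mult_exp_minus_le_1: "(1 + x) * exp (- x) \<le> 1" for x :: real
  using exp_ge_add_one_self[of x] by (simp add: exp_minus field_simps)

text \<open>Trapezoidal rule: \<open>1 - exp (- x)\<close> is the integral over
  \<open>[0, x]\<close> of the convex function \<open>exp (- t)\<close>, hence at most
  \<open>x\<close> times the mean of its endpoint values.\<close>

lemma two_times_one_minus_exp_le:
  fixes x :: real
  assumes "x \<ge> 0"
  shows "2 * (1 - exp (- x)) \<le> x * (1 + exp (- x))"
proof -
  let ?f = "\<lambda>x::real. x * (1 + exp (- x)) - 2 * (1 - exp (- x))"
  have "?f 0 \<le> ?f x"
  proof (rule DERIV_nonneg_imp_nondecreasing[OF assms])
    fix y :: real
    have "(?f has_real_derivative 1 - (1 + y) * exp (- y)) (at y)"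
      by (auto intro!: derivative_eq_intros simp: algebra_simps)
    then show "\<exists>D. (?f has_real_derivative D) (at y) \<and> 0 \<le> D"
      using one_plus_mult_exp_minus_le_1[of y] by auto
  qed
  then show ?thesis by simp
qed

text \<open>Controls the gap between \<open>\<phi>\<close> and \<open>E\<close> when
  \<open>\<sigma> \<le> 1\<close>: for \<open>x > 0\<close> the left side is
  \<open>4 * x * (\<phi> - E)\<close>.\<close>

lemma four_times_one_minus_exp_le:
  fixes x :: real
  assumes "x \<ge> 0"
  shows "4 * (1 - (1 + x) * exp (- x)) \<le> x\<^sup>2 * (1 + exp (- x))"
proof -
  let ?f = "\<lambda>x::real. x\<^sup>2 * (1 + exp (- x)) - 4 * (1 - (1 + x) * exp (- x))"
  have "?f 0 \<le> ?f x"
  proof (rule DERIV_nonneg_imp_nondecreasing[OF assms])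
    fix y :: real
    assume "0 \<le> y"
    have "(?f has_real_derivative y * (2 - (2 + y) * exp (- y))) (at y)"
      by (auto intro!: derivative_eq_intros simp: algebra_simps power2_eq_square)
    moreover have "exp (- y) \<le> 1"
      using \<open>0 \<le> y\<close> by simp
    \<comment> \<open>Split into \<open>(1 + y) * exp (- y)\<close> and \<open>exp (- y)\<close>,
      each at most 1.\<close>
    then have "(2 + y) * exp (- y) \<le> 2"
      using one_plus_mult_exp_minus_le_1[of y] unfolding distrib_right by linarith
    then have "0 \<le> y * (2 - (2 + y) * exp (- y))"
      using \<open>0 \<le> y\<close> by simp
    ultimately show "\<exists>D. (?f has_real_derivative D) (at y) \<and> 0 \<le> D"
      by blast
  qed
  then show ?thesis by simp
qed

text \<open>The left side is \<open>|G|^2\<close> with the angle eliminated,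
  \<open>s * (2 - s)\<close> standing for the squared sine. The case \<open>s = 0\<close>, where
  \<open>x\<close> vanishes, is left to the main proof.\<close>

lemma growth_factor_bound:
  fixes q s \<sigma> x E \<phi> :: real
  assumes "q > 0" "0 < s" "s \<le> 2" "\<sigma> \<ge> 0"
    and cfl: "\<sigma>\<^sup>2 \<le> 2 * q \<or> \<sigma> \<le> 1"
    and x: "x = 2 * q * s" and E: "E = exp (- x)" and \<phi>: "\<phi> = (1 - E) / x"
  shows "(E - \<phi> * \<sigma> * s)\<^sup>2 + (\<phi> * \<sigma>)\<^sup>2 * (s * (2 - s)) \<le> 1"
proof -
  have "x > 0" using assms by simp
  have x\<phi>: "x * \<phi> = 1 - E" using \<open>x > 0\<close> \<phi> by simp
  have "E > 0" "E < 1" using E \<open>x > 0\<close> by auto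
  then have "\<phi> > 0" using \<phi> \<open>x > 0\<close> by simp
  have key: "\<phi> * \<sigma>\<^sup>2 \<le> q * (1 + E) + \<sigma> * E"
    using cfl
  proof
    assume "\<sigma>\<^sup>2 \<le> 2 * q"
    have "x * (2 * \<phi>) = 2 * (1 - E)"
      using x\<phi> by simp
    also have "\<dots> \<le> x * (1 + E)"
      using two_times_one_minus_exp_le[of x] \<open>x > 0\<close> E by simp
    finally have "2 * \<phi> \<le> 1 + E" using \<open>x > 0\<close> by simp
    then have "q * (2 * \<phi>) \<le> q * (1 + E)" using \<open>q > 0\<close> by simp
    moreover have "\<phi> * \<sigma>\<^sup>2 \<le> \<phi> * (2 * q)"
      using \<open>\<sigma>\<^sup>2 \<le> 2 * q\<close> \<open>\<phi> > 0\<close> by simp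
    moreover have "0 \<le> \<sigma> * E" using \<open>\<sigma> \<ge> 0\<close> \<open>E > 0\<close> by simp
    ultimately show ?thesis by (simp add: mult_ac)
  next
    assume "\<sigma> \<le> 1"
    have x\<phi>E: "x * (\<phi> - E) = 1 - (1 + x) * E"
      using x\<phi> by (simp add: algebra_simps)
    also have "\<dots> \<ge> 0"
      using one_plus_mult_exp_minus_le_1[of x] E by simp
    finally have "\<phi> - E \<ge> 0"
      using \<open>x > 0\<close> by (simp add: zero_le_mult_iff)
    have "x * (4 * (\<phi> - E)) = 4 * (1 - (1 + x) * E)"
      using x\<phi>E by (metis mult.left_commute)
    also have "\<dots> \<le> x * (x * (1 + E))"
      using four_times_one_minus_exp_le[of x] \<open>x > 0\<close> E
      by (simp add: power2_eq_square mult.assoc)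
    finally have bound: "4 * (\<phi> - E) \<le> x * (1 + E)"
      using \<open>x > 0\<close> by (simp only: mult_le_cancel_left_pos)
    \<comment> \<open>The highest frequency, \<open>s = 2\<close>, is the worst case; it accounts
      for the constant 4 in the bound on \<open>\<phi> - E\<close>.\<close>
    have "x \<le> 4 * q" using x \<open>q > 0\<close> \<open>s \<le> 2\<close> by simp
    then have "x * (1 + E) \<le> 4 * q * (1 + E)"
      using \<open>E > 0\<close> by (intro mult_right_mono) auto
    with bound have "\<phi> - E \<le> q * (1 + E)" by simp
    moreover have "\<sigma> * (\<phi> - E) \<le> \<phi> - E"
      using \<open>\<sigma> \<le> 1\<close> \<open>\<phi> - E \<ge> 0\<close> \<open>\<sigma> \<ge> 0\<close> by (simp add: mult_left_le_one_le)
    moreover have "\<sigma>\<^sup>2 \<le> \<sigma>"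
      using \<open>\<sigma> \<le> 1\<close> \<open>\<sigma> \<ge> 0\<close> by (simp add: power2_eq_square mult_left_le)
    then have "\<phi> * \<sigma>\<^sup>2 \<le> \<phi> * \<sigma>" using \<open>\<phi> > 0\<close> by simp
    ultimately show ?thesis by (simp add: algebra_simps)
  qed
  \<comment> \<open>The terms in \<open>s\<^sup>2\<close> cancel. Replacing \<open>1 - E\<close> by
    \<open>x * \<phi> = 2 * q * s * \<phi>\<close> then exposes the common factor
    \<open>2 * s * \<phi>\<close>.\<close>
  have "1 - ((E - \<phi> * \<sigma> * s)\<^sup>2 + (\<phi> * \<sigma>)\<^sup>2 * (s * (2 - s)))
      = (1 - E) * (1 + E) + 2 * s * \<phi> * (\<sigma> * E - \<phi> * \<sigma>\<^sup>2)"
    by (simp add: power2_eq_square algebra_simps)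
  also have "\<dots> = 2 * s * \<phi> * (q * (1 + E) + \<sigma> * E - \<phi> * \<sigma>\<^sup>2)"
    unfolding x\<phi>[symmetric] x by (simp add: algebra_simps)
  also have "\<dots> \<ge> 0"
    using key \<open>0 < s\<close> \<open>\<phi> > 0\<close> by simp
  finally show ?thesis by simp
qed

lemma fourier_mode_shift:
  "fourier_mode h \<omega> (j + 1) = cis (of_int \<omega> * h) * fourier_mode h \<omega> j"
  "fourier_mode h \<omega> (j - 1) = cnj (cis (of_int \<omega> * h)) * fourier_mode h \<omega> j"
  by (simp_all add: fourier_mode_def cis_conv_exp exp_add[symmetric] exp_cnj algebra_simps)

lemma diff_op_fourier_mode:
  "diff_op d h (\<lambda>i. c * fourier_mode h \<omega> i) j
     = of_real (- (2 * (d / h\<^sup>2) * (1 - cos (of_int \<omega> * h)))) * (c * fourier_mode h \<omega> j)"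
proof -
  have "2 * complex_of_real (cos (of_int \<omega> * h))
      = cis (of_int \<omega> * h) + cnj (cis (of_int \<omega> * h))"
    by (simp add: complex_add_cnj)
  then show ?thesis
    unfolding diff_op_def fourier_mode_shift
    by (simp add: algebra_simps diff_divide_distrib add_divide_distrib)
qed

lemma adv_op_fourier_mode:
  "adv_op a h (\<lambda>i. c * fourier_mode h \<omega> i) j
     = of_real (a / h) * (1 - cnj (cis (of_int \<omega> * h))) * (c * fourier_mode h \<omega> j)"
  unfolding adv_op_def fourier_mode_shift by (simp add: algebra_simps diff_divide_distrib)

text \<open>\<open>A\<close> only rescales the mode, and a power series in \<open>\<tau> D\<close>
  acts on it as its value at the eigenvalue \<open>\<tau> \<mu>\<close>.\<close>

lemma is_growth_factor_etd_rk1_step: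
  assumes D: "\<And>c j. D (\<lambda>i. c * fourier_mode h \<omega> i) j = \<mu> * (c * fourier_mode h \<omega> j)"
    and A: "\<And>c j. A (\<lambda>i. c * fourier_mode h \<omega> i) j = \<alpha> * (c * fourier_mode h \<omega> j)"
  shows "is_growth_factor (etd_rk1_step D A \<tau>) h \<omega>
           (exp (of_real \<tau> * \<mu>) - of_real \<tau> * phi1 (of_real \<tau> * \<mu>) * \<alpha>)"
proof -
  have op: "op_fun f (scale_op \<tau> D) (\<lambda>i. c * fourier_mode h \<omega> i) j
      = f (of_real \<tau> * \<mu>) * (c * fourier_mode h \<omega> j)" if "f holomorphic_on UNIV" for f c j
    using that
  proof (rule op_fun_eigenvector)
    show "scale_op \<tau> D (\<lambda>j. b * (c * fourier_mode h \<omega> j))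
        = (\<lambda>j. of_real \<tau> * \<mu> * b * (c * fourier_mode h \<omega> j))" for b
      using D[of "b * c"] by (simp add: scale_op_def mult.assoc)
  qed
  have Ac: "A (\<lambda>i. c * fourier_mode h \<omega> i) = (\<lambda>i. \<alpha> * c * fourier_mode h \<omega> i)" for c
    using A by (auto simp: mult.assoc)
  \<comment> \<open>Only the outer \<open>scale_op\<close> is unfolded; the one inside
    \<open>op_fun\<close> must stay intact for \<open>op\<close> to match.\<close>
  show ?thesis
    unfolding is_growth_factor_def etd_rk1_step_def
      scale_op_def[of \<tau> "op_fun phi1 (scale_op \<tau> D)"] Ac
      op[OF holomorphic_on_exp] op[OF phi1_holomorphic]
    by (simp add: algebra_simps)
qed

theorem corollary3p2:
  fixes a d \<tau> h :: real and N :: nat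
  assumes "a > 0" and "d > 0"
    and "N > 0" and "even N"
    and "h = 2 * pi / real N"
    and "\<tau> > 0"
    and "\<tau> \<le> max (2 * (d / a ^ 2)) (h / a)"
  shows "fourier_stable (upwind_etd_rk1 a d h \<tau>) N h"
  unfolding fourier_stable_def
proof
  fix \<omega> :: int
  have "h > 0" using assms by simp
  define \<theta> where "\<theta> = of_int \<omega> * h"
  define s where "s = 1 - cos \<theta>"
  define \<sigma> where "\<sigma> = a * \<tau> / h"
  define q where "q = d * \<tau> / h\<^sup>2"
  define x where "x = 2 * q * s"
  define E where "E = exp (- x)"
  define \<mu> where "\<mu> = complex_of_real (- (2 * (d / h\<^sup>2) * s))"
  define \<alpha> where "\<alpha> = of_real (a / h) * (1 - cnj (cis \<theta>))"
  define G where "G = exp (of_real \<tau> * \<mu>) - of_real \<tau> * phi1 (of_real \<tau> * \<mu>) * \<alpha>"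
  have "is_growth_factor (upwind_etd_rk1 a d h \<tau>) h \<omega> G"
    unfolding upwind_etd_rk1_def G_def \<mu>_def \<alpha>_def s_def \<theta>_def
    by (intro is_growth_factor_etd_rk1_step diff_op_fourier_mode adv_op_fourier_mode)
  moreover have "cmod G \<le> 1"
  \<comment> \<open>If \<open>s = 0\<close> the mode is constant, both eigenvalues vanish and
    \<open>G = 1\<close>.\<close>
  proof (cases "s = 0")
    case True
    then have "cos \<theta> = 1" by (simp add: s_def)
    then have "cis \<theta> = 1" using sin_cos_squared_add[of \<theta>] by (simp add: complex_eq_iff)
    then show ?thesis using True by (simp add: G_def \<mu>_def \<alpha>_def)
  next
    case False
    then have s: "0 < s" "s \<le> 2"
      using cos_le_one[of \<theta>] cos_ge_minus_one[of \<theta>] unfolding s_def by linarith+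
    have "q > 0" "\<sigma> \<ge> 0" using assms \<open>h > 0\<close> by (simp_all add: q_def \<sigma>_def)
    then have "x \<noteq> 0" using s by (simp add: x_def)
    \<comment> \<open>Multiplied by \<open>a\<^sup>2 * \<tau> / h\<^sup>2\<close>, the diffusive
      bound becomes \<open>\<sigma>\<^sup>2 \<le> 2 * q\<close>; multiplied by \<open>a / h\<close>,
      the advective bound becomes \<open>\<sigma> \<le> 1\<close>.\<close>
    have "\<tau> \<le> 2 * (d / a\<^sup>2) \<or> \<tau> \<le> h / a" using assms(7) by (simp add: le_max_iff_disj)
    then have cfl: "\<sigma>\<^sup>2 \<le> 2 * q \<or> \<sigma> \<le> 1"
    proof
      assume "\<tau> \<le> 2 * (d / a\<^sup>2)"
      then have "a\<^sup>2 * \<tau> \<le> 2 * d" using \<open>a > 0\<close> by (simp add: field_simps)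
      then have "a\<^sup>2 * \<tau> * (\<tau> / h\<^sup>2) \<le> 2 * d * (\<tau> / h\<^sup>2)"
        using \<open>\<tau> > 0\<close> by (intro mult_right_mono) auto
      then show ?thesis
        by (simp add: \<sigma>_def q_def power_mult_distrib power_divide power2_eq_square mult_ac)
    next
      assume "\<tau> \<le> h / a"
      then show ?thesis using \<open>a > 0\<close> \<open>h > 0\<close> by (simp add: \<sigma>_def field_simps)
    qed
    define \<phi> where "\<phi> = (1 - E) / x"
    have \<tau>\<mu>: "of_real \<tau> * \<mu> = of_real (- x)"
      by (simp add: \<mu>_def x_def q_def mult_ac)
    \<comment> \<open>Since \<open>x \<noteq> 0\<close>, the quotient branch of \<open>phi1\<close>
      applies, and the two minus signs cancel.\<close>
    have "phi1 (of_real (- x)) = of_real \<phi>"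
      using \<open>x \<noteq> 0\<close> unfolding phi1_def exp_of_real
      by (simp add: \<phi>_def E_def field_simps)
    then have "G = of_real E - of_real \<tau> * of_real \<phi> * \<alpha>"
      unfolding G_def \<tau>\<mu> exp_of_real E_def by simp
    then have "Re G = E - \<phi> * \<sigma> * s" "Im G = - (\<phi> * \<sigma> * sin \<theta>)"
      by (simp_all add: \<alpha>_def \<sigma>_def s_def mult_ac)
    then have "(cmod G)\<^sup>2 = (E - \<phi> * \<sigma> * s)\<^sup>2 + (\<phi> * \<sigma>)\<^sup>2 * (sin \<theta>)\<^sup>2"
      by (simp add: cmod_power2 power_mult_distrib)
    also have "(sin \<theta>)\<^sup>2 = s * (2 - s)"
      by (simp add: s_def sin_squared_eq power2_eq_square algebra_simps)
    also have "(E - \<phi> * \<sigma> * s)\<^sup>2 + (\<phi> * \<sigma>)\<^sup>2 * (s * (2 - s)) \<le> 1"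
      using \<open>q > 0\<close> s \<open>\<sigma> \<ge> 0\<close> cfl x_def E_def \<phi>_def by (rule growth_factor_bound)
    finally show ?thesis by (simp add: power_le_one_iff abs_square_le_1)
  qed
  ultimately show "\<exists>G. is_growth_factor (upwind_etd_rk1 a d h \<tau>) h \<omega> G \<and> cmod G \<le> 1"
    by blast
qed

end
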